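(* Let $k\leq 8$ be a positive integer. Then the set of odd positive integers $n$ with $s_2(n^2)=s_2(n)=k$ is finite.
   Context: $s_2(m)$ denotes the sum of the binary digits of the nonnegative integer $m$. *)

theory Defs
  imports Main
begin

fun s2 :: "nat \<Rightarrow> nat" where
  "s2 m = (if m = 0 then 0 else m mod 2 + s2 (m div 2))"

declare s2.simps [simp del]

end

theory Submission
  imports Defs "HOL-Library.Nat_Bijection" "HOL-Computational_Algebra.Primes"
begin

text \<open>
  Let \<open>R\<close> be the set of exponents of \<open>n\<close>. By pigeonhole over rapidly growing scales there is a scale
  at which every difference of two sums of exponents is either short or much longer. If \<open>n\<close> is
  large, \<open>R\<close> then splits into \<open>m + 1 \<ge> 2\<close> short blocks far apart, so \<open>n\<close> is a sum of numbers
  \<open>A\<^sub>0, \<dots>, A\<^sub>m\<close> with widely separated supports, and the products \<open>A\<^sub>i A\<^sub>j\<close> fall into clusters of digits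
  of \<open>n\<^sup>2\<close> that do not interact. The sums \<open>2x\<^sub>0 < x\<^sub>0 + x\<^sub>1 < 2x\<^sub>1 < \<dots> < 2x\<^sub>m\<close> of block positions lie in
  distinct clusters, which gives at least \<open>9\<close> digits if \<open>m \<ge> 4\<close>. For \<open>m = 2, 3\<close> the clusters of
  \<open>A\<^sub>0\<^sup>2\<close>, \<open>A\<^sub>0 A\<^sub>1\<close>, \<open>A\<^bsub>m-1\<^esub> A\<^sub>m\<close>, \<open>A\<^sub>m\<^sup>2\<close> together with the \<open>2m - 3\<close> middle ones already carry more than
  \<open>k\<close> digits. For \<open>m = 1\<close> one needs that a square of a number with \<open>4\<close> to \<open>6\<close> digits \<open>1\<close> has at
  least \<open>4\<close> digits \<open>1\<close>, except for \<open>23\<^sup>2 = 529\<close> up to powers of \<open>4\<close>.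
\<close>

subsection \<open>Binary digit sums\<close>

lemma s2_0 [simp]: "s2 0 = 0"
  by (simp add: s2.simps)

lemma s2_Suc_0 [simp]: "s2 (Suc 0) = Suc 0"
  by (simp add: s2.simps)

lemma s2_double: "s2 (2 * n) = s2 n"
  by (cases "n = 0") (simp_all add: s2.simps [of "2 * n"])

lemma s2_double_Suc: "s2 (Suc (2 * n)) = Suc (s2 n)"
  by (simp add: s2.simps [of "Suc (2 * n)"])

lemma s2_power_mult: "s2 (2 ^ j * n) = s2 n"
  by (induction j) (simp_all add: s2_double mult.assoc)

text \<open>Halving the code shifts every exponent down by one, and its parity tells whether
  \<open>0\<close> is an exponent.\<close>

lemma s2_set_encode: "finite A \<Longrightarrow> s2 (set_encode A) = card A"
proof (induction "set_encode A" arbitrary: A rule: less_induct)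
  case less
  show ?case
  proof (cases "set_encode A = 0")
    case True
    then have "A = {}"
      using set_encode_inverse [OF less.prems] by auto
    then show ?thesis by simp
  next
    case False
    let ?B = "Suc -` A"
    have fin: "finite ?B"
      using less.prems by (simp add: finite_vimage_Suc_iff)
    have IH: "s2 (set_encode A div 2) = card ?B"
      using less.hyps [of ?B] False fin set_encode_vimage_Suc [of A] by simp
    have "A = (A \<inter> {0}) \<union> Suc ` ?B"
    proof (intro set_eqI)
      fix x show "x \<in> A \<longleftrightarrow> x \<in> (A \<inter> {0}) \<union> Suc ` ?B"
        by (cases x) auto
    qed
    moreover have "card ((A \<inter> {0}) \<union> Suc ` ?B) = card (A \<inter> {0}) + card (Suc ` ?B)"
      by (rule card_Un_disjoint) (use fin in \<open>auto simp del: image_vimage_eq\<close>)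
    ultimately have "card A = (if 0 \<in> A then 1 else 0) + card ?B"
      by (simp add: card_image del: image_vimage_eq)
    moreover have "set_encode A mod 2 = (if 0 \<in> A then 1 else 0)"
      using even_set_encode_iff [OF less.prems] by (simp add: mod_2_eq_odd)
    ultimately show ?thesis
      using IH False by (subst s2.simps) simp
  qed
qed

lemma s2_eq_card: "s2 n = card (set_decode n)"
  using s2_set_encode [of "set_decode n"] by simp

lemma s2_add_disjoint:
  assumes "set_decode x \<inter> set_decode y = {}"
  shows "s2 (x + y) = s2 x + s2 y"
proof -
  have "x + y = set_encode (set_decode x \<union> set_decode y)"
    using assms sum.union_disjoint [of "set_decode x" "set_decode y" "(^) (2::nat)"]
      set_decode_inverse [of x] set_decode_inverse [of y]
    by (simp add: set_encode_def)
  then show ?thesis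
    using assms by (simp add: s2_set_encode s2_eq_card card_Un_disjoint)
qed

lemma s2_eq_0_iff: "s2 n = 0 \<longleftrightarrow> n = 0"
  by (metis card_0_eq finite_set_decode s2_eq_card set_decode_inverse set_decode_zero set_encode_empty)

lemma s2_pos: "0 < n \<Longrightarrow> 1 \<le> s2 n"
  using s2_eq_0_iff [of n] by linarith

lemma s2_eq_1_iff: "s2 n = 1 \<longleftrightarrow> (\<exists>j. n = 2 ^ j)"
proof
  assume "s2 n = 1"
  then obtain j where "set_decode n = {j}"
    by (metis card_1_singletonE s2_eq_card)
  then have "n = 2 ^ j"
    using set_decode_inverse [of n] by simp
  then show "\<exists>j. n = 2 ^ j" ..
next
  assume "\<exists>j. n = 2 ^ j"
  then show "s2 n = 1"
    using s2_power_mult [of _ 1] by auto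
qed

lemma s2_div_2_le: "s2 (n div 2) \<le> s2 n"
  by (cases "n = 0") (simp_all add: s2.simps [of n])

text \<open>Lets the leading digits of a number alone bound its digit sum from below.\<close>

lemma s2_div_power_2_le: "s2 (n div 2 ^ j) \<le> s2 n"
proof (induction j)
  case (Suc j)
  have "n div 2 ^ Suc j = n div 2 ^ j div 2"
    by (simp only: power_Suc2 div_mult2_eq)
  then show ?case
    using order_trans [OF s2_div_2_le Suc] by metis
qed simp

subsection \<open>Sums of powers of two over pairs of exponents\<close>

text \<open>Expands a square over ordered pairs of exponents before any carrying, so that clusters
  of digits of the square become subsets of \<open>R \<times> R\<close>.\<close>

definition pair_sum :: "(nat \<times> nat) set \<Rightarrow> nat" where
  "pair_sum T = (\<Sum>(a, b)\<in>T. 2 ^ (a + b))"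

lemma pair_sum_Times: "pair_sum (A \<times> B) = set_encode A * set_encode B"
  by (simp add: pair_sum_def set_encode_def sum_product sum.cartesian_product power_add)

lemma pair_sum_Un:
  assumes "finite S" "finite T" "S \<inter> T = {}"
  shows "pair_sum (S \<union> T) = pair_sum S + pair_sum T"
  using assms by (simp add: pair_sum_def sum.union_disjoint)

lemma pair_sum_pos:
  assumes "finite T" "t \<in> T"
  shows "0 < pair_sum T"
  unfolding pair_sum_def by (rule sum_pos2 [OF assms]) (auto simp: split_beta)

text \<open>Carries travel at most \<open>l\<close> places when \<open>2 ^ l\<close> powers of two are added.\<close>

lemma set_decode_pair_sum:
  assumes T: "finite T" "card T \<le> 2 ^ l" and x: "x \<in> set_decode (pair_sum T)"
  shows "\<exists>(a, b)\<in>T. a + b \<le> x \<and> x \<le> a + b + l"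
proof (rule ccontr)
  assume neg: "\<not> ?thesis"
  \<comment> \<open>If no pair sum is close to \<open>x\<close>, the terms in \<open>L\<close> are
    too few and too small to carry into place \<open>x\<close>, while those in \<open>H\<close> are
    multiples of \<open>2 ^ Suc x\<close>; so digit \<open>x\<close> would be
    \<open>0\<close>.\<close>
  define L where "L = {t \<in> T. fst t + snd t + l < x}"
  define H where "H = {t \<in> T. x < fst t + snd t}"
  have "t \<in> L \<or> t \<in> H" if "t \<in> T" for t
  proof -
    have "\<not> (fst t + snd t \<le> x \<and> x \<le> fst t + snd t + l)"
      using neg that by (auto simp: split_beta)
    then show ?thesis
      using that unfolding L_def H_def by auto
  qed
  then have "T = L \<union> H" "L \<inter> H = {}"
    by (auto simp: L_def H_def)
  then have eq: "pair_sum T = pair_sum L + pair_sum H"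
    using T pair_sum_Un [of L H] by (simp add: L_def H_def)
  have "2 ^ Suc x dvd pair_sum H"
    unfolding pair_sum_def
  proof (rule dvd_sum, clarify)
    fix a b assume "(a, b) \<in> H"
    then show "(2::nat) ^ Suc x dvd 2 ^ (a + b)"
      by (intro le_imp_power_dvd) (auto simp: H_def)
  qed
  then obtain h where h: "pair_sum H = 2 ^ x * (2 * h)"
    by (auto simp: dvd_def)
  have "pair_sum L < 2 ^ x"
  proof (cases "L = {}")
    case False
    then have "l < x"
      by (auto simp: L_def)
    have "pair_sum L \<le> of_nat (card L) * 2 ^ (x - Suc l)"
      unfolding pair_sum_def
      by (rule sum_bounded_above) (auto simp: L_def intro!: power_increasing)
    also have "\<dots> \<le> 2 ^ l * 2 ^ (x - Suc l)"
    proof -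
      have "card L \<le> card T"
        using T by (auto simp: L_def intro: card_mono)
      then have "card L \<le> 2 ^ l"
        using T(2) by linarith
      then show ?thesis by simp
    qed
    also have "\<dots> = 2 ^ (x - 1)"
      using \<open>l < x\<close> by (simp flip: power_add)
    also have "\<dots> < 2 ^ x"
      using \<open>l < x\<close> by simp
    finally show ?thesis .
  qed (simp add: pair_sum_def)
  then have "pair_sum T div 2 ^ x = 2 * h"
    unfolding eq h by simp
  then show False
    using x by (simp add: set_decode_def)
qed

text \<open>There are at most \<open>64 = 2 ^ 6\<close> pairs in \<open>R \<times> R\<close>, so
  carries from \<open>S\<close> travel at most \<open>6\<close> places and never meet the digits of
  \<open>T\<close>.\<close>

lemma s2_pair_sum_Un:
  assumes R: "finite R" "card R \<le> 8" and ST: "S \<subseteq> R \<times> R" "T \<subseteq> R \<times> R"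
    and sep: "\<And>a b c d. (a, b) \<in> S \<Longrightarrow> (c, d) \<in> T \<Longrightarrow> a + b + 6 < c + d"
  shows "s2 (pair_sum (S \<union> T)) = s2 (pair_sum S) + s2 (pair_sum T)"
proof -
  have RR: "finite (R \<times> R)" "card (R \<times> R) \<le> 2 ^ 6"
    using R mult_mono [of "card R" 8 "card R" 8] by (simp_all add: card_cartesian_product)
  have small: "finite U" "card U \<le> 2 ^ 6" if "U \<subseteq> R \<times> R" for U
    using RR that card_mono [OF RR(1) that] finite_subset [OF that RR(1)] by linarith+
  have "S \<inter> T = {}"
    using sep by force
  then have "pair_sum (S \<union> T) = pair_sum S + pair_sum T"
    using ST by (intro pair_sum_Un small)
  moreover have "set_decode (pair_sum S) \<inter> set_decode (pair_sum T) = {}"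
  proof (rule ccontr)
    assume "\<not> ?thesis"
    then obtain x where x: "x \<in> set_decode (pair_sum S)" "x \<in> set_decode (pair_sum T)"
      by blast
    obtain a b where "(a, b) \<in> S" "x \<le> a + b + 6"
      using set_decode_pair_sum [OF small [OF ST(1)] x(1)] by blast
    moreover obtain c d where "(c, d) \<in> T" "c + d \<le> x"
      using set_decode_pair_sum [OF small [OF ST(2)] x(2)] by blast
    ultimately show False
      using sep by fastforce
  qed
  ultimately show ?thesis
    by (simp add: s2_add_disjoint)
qed

subsection \<open>Gapped sets of exponents\<close>

text \<open>Meant for the set of pair sums: differences up to \<open>D\<close> stay inside a
  cluster, differences above \<open>E\<close> separate clusters.\<close>

definition gapped :: "nat \<Rightarrow> nat \<Rightarrow> nat set \<Rightarrow> bool" where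
  "gapped D E P \<longleftrightarrow> (\<forall>x\<in>P. \<forall>y\<in>P. x \<le> y \<longrightarrow> y \<le> x + D \<or> x + E < y)"

abbreviation pair_sums :: "nat set \<Rightarrow> nat set" where
  "pair_sums R \<equiv> (\<lambda>(a, b). a + b) ` (R \<times> R)"

lemma gappedD: "gapped D E P \<Longrightarrow> x \<in> P \<Longrightarrow> y \<in> P \<Longrightarrow> x \<le> y \<Longrightarrow> y \<le> x + D \<or> x + E < y"
  unfolding gapped_def by blast

lemma gapped_mono: "gapped D E P \<Longrightarrow> Q \<subseteq> P \<Longrightarrow> gapped D E Q"
  unfolding gapped_def by blast

lemma pair_sumsI: "a \<in> R \<Longrightarrow> b \<in> R \<Longrightarrow> a + b \<in> pair_sums R"
  by (rule rev_image_eqI [of "(a, b)"]) auto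

text \<open>Adding \<open>x\<close> to both \<open>x\<close> and \<open>y\<close> keeps their
  difference and turns them into pair sums.\<close>

lemma gapped_summand:
  assumes "gapped D E (pair_sums R)"
  shows "gapped D E R"
  unfolding gapped_def
proof (intro ballI impI)
  fix x y assume "x \<in> R" "y \<in> R" "x \<le> y"
  then have "x + x \<in> pair_sums R" "y + x \<in> pair_sums R" "x + x \<le> y + x"
    by (simp_all add: pair_sumsI del: image_iff)
  then have "y + x \<le> x + x + D \<or> x + x + E < y + x"
    using assms unfolding gapped_def by blast
  then show "y \<le> x + D \<or> x + E < y" by linarith
qed

text \<open>The gap after \<open>x\<close> gives \<open>x + E < b\<close>, hence
  \<open>b - a > E - D \<ge> D\<close>; the difference from \<open>a\<close> is then not short, so
  it must be long.\<close>

lemma gapped_cut: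
  assumes "gapped D E P" "2 * D \<le> E" "x \<in> P" "a \<in> P" "b \<in> P" "a \<le> x + D" "x + D < b"
  shows "a + E < b"
proof -
  have "b \<le> x + D \<or> x + E < b" "b \<le> a + D \<or> a + E < b"
    using gappedD [OF assms(1,3,5)] gappedD [OF assms(1,4,5)] assms(6,7) by linarith+
  then show ?thesis
    using assms by linarith
qed

lemma gapped_lowest_block:
  assumes "gapped D E R" "2 * D \<le> E" "R \<noteq> {}"
  obtains x A B where "R = A \<union> B" "A \<inter> B = {}" "x \<in> A"
    "\<And>a. a \<in> A \<Longrightarrow> x \<le> a \<and> a \<le> x + D" "\<And>a b. a \<in> A \<Longrightarrow> b \<in> B \<Longrightarrow> a + E < b"
proof -
  define x where "x = (LEAST x. x \<in> R)"
  have x: "x \<in> R" "\<And>r. r \<in> R \<Longrightarrow> x \<le> r"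
    using \<open>R \<noteq> {}\<close> LeastI_ex [of "\<lambda>x. x \<in> R"] Least_le [of "\<lambda>x. x \<in> R"] by (auto simp: x_def)
  show ?thesis
  proof (rule that [of "{r \<in> R. r \<le> x + D}" "{r \<in> R. x + D < r}" x])
    fix a b assume "a \<in> {r \<in> R. r \<le> x + D}" "b \<in> {r \<in> R. x + D < r}"
    then show "a + E < b"
      using gapped_cut [OF assms(1,2) x(1)] by simp
  qed (use x in auto)
qed

text \<open>Each point of \<open>Q\<close> owns a nonzero cluster that contributes at least one
  digit; the induction splits off the lowest one.\<close>

lemma card_le_s2_pair_sum:
  assumes R: "finite R" "card R \<le> 8" and gap: "gapped D E (pair_sums R)" "2 * D \<le> E" "6 \<le> E"
    and "finite Q" "T \<subseteq> R \<times> R" "Q \<subseteq> (\<lambda>(a, b). a + b) ` T"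
      "\<And>p q. p \<in> Q \<Longrightarrow> q \<in> Q \<Longrightarrow> p < q \<Longrightarrow> p + D < q"
  shows "card Q \<le> s2 (pair_sum T)"
  using assms(6-)
proof (induction Q arbitrary: T rule: finite_linorder_min_induct)
  case (insert q Q)
  \<comment> \<open>\<open>C\<close> also takes in the sums below \<open>q\<close>, so all that
    remains lies far above the whole of \<open>C\<close>.\<close>
  define C where "C = {t \<in> T. fst t + snd t \<le> q + D}"
  obtain c d where cd: "(c, d) \<in> T" "q = c + d"
    using insert.prems by auto
  have q: "q \<in> pair_sums R"
    using cd insert.prems(1) pair_sumsI by blast
  have "s2 (pair_sum (C \<union> (T - C))) = s2 (pair_sum C) + s2 (pair_sum (T - C))"
  proof (rule s2_pair_sum_Un [OF R])
    fix a b a' b' assume t: "(a, b) \<in> C" "(a', b') \<in> T - C"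
    then have "a + b \<in> pair_sums R" "a' + b' \<in> pair_sums R"
      using insert.prems(1) pair_sumsI by (auto simp: C_def simp del: image_iff)
    then have "a + b + E < a' + b'"
      using t by (intro gapped_cut [OF gap(1,2) q]) (auto simp: C_def)
    then show "a + b + 6 < a' + b'"
      using gap by linarith
  qed (use insert.prems in \<open>auto simp: C_def\<close>)
  moreover have "C \<union> (T - C) = T"
    by (auto simp: C_def)
  moreover have "card Q \<le> s2 (pair_sum (T - C))"
  proof (rule insert.IH)
    show "Q \<subseteq> (\<lambda>(a, b). a + b) ` (T - C)"
    proof
      fix p assume p: "p \<in> Q"
      then obtain a b where ab: "(a, b) \<in> T" "p = a + b"
        using insert.prems by auto
      moreover have "q + D < p"
        using insert.prems(3) [of q p] insert.hyps p by auto
      ultimately show "p \<in> (\<lambda>(a, b). a + b) ` (T - C)"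
        by (auto simp: C_def intro: rev_image_eqI)
    qed
  qed (use insert.prems in auto)
  moreover have "1 \<le> s2 (pair_sum C)"
  proof (intro s2_pos pair_sum_pos)
    show "finite C"
      using R finite_subset [OF insert.prems(1)] by (simp add: C_def)
    show "(c, d) \<in> C"
      using cd by (simp add: C_def)
  qed
  ultimately show ?case
    using insert.hyps by auto
qed simp

section \<open>Digit sums of products\<close>

lemma s2_eq_1_mult: "s2 x = 1 \<Longrightarrow> s2 (x * y) = s2 y"
  using s2_eq_1_iff [of x] s2_power_mult by auto

text \<open>A product that is a power of two has only powers of two as factors.\<close>

lemma s2_mult_ge_2:
  assumes "2 \<le> s2 x" "0 < y"
  shows "2 \<le> s2 (x * y)"
proof -
  have "0 < x"
    using assms(1) by (cases "x = 0") auto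
  have "s2 (x * y) \<noteq> 1"
  proof
    assume "s2 (x * y) = 1"
    then obtain j where "x * y = 2 ^ j"
      using s2_eq_1_iff by blast
    then obtain i where "x = 2 ^ i"
      using divides_primepow_nat [of 2 x j] by (metis dvd_triv_left two_is_prime_nat)
    then show False
      using assms(1) s2_eq_1_iff [of x] by auto
  qed
  then show ?thesis
    using s2_pos [of "x * y"] \<open>0 < x\<close> \<open>0 < y\<close> by simp
qed

text \<open>The two mirror-image rectangles add up to twice the product, and doubling keeps the
  digit sum.\<close>

lemma pair_sum_cross:
  assumes "finite A" "finite B" "A \<inter> B = {}"
  shows "s2 (pair_sum (A \<times> B \<union> B \<times> A)) = s2 (set_encode A * set_encode B)"
proof -
  have "pair_sum (A \<times> B \<union> B \<times> A) = 2 * (set_encode A * set_encode B)"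
    using assms by (subst pair_sum_Un) (auto simp: pair_sum_Times)
  then show ?thesis
    by (simp add: s2_double)
qed

subsection \<open>Decomposition into blocks\<close>

text \<open>The bound on \<open>E\<close> covers the spread \<open>2 * D\<close> of sums from two
  blocks of width \<open>D\<close> and the carry length \<open>6\<close>.\<close>

locale gapped_exponents =
  fixes D E :: nat and R :: "nat set"
  assumes fin: "finite R" and card8: "card R \<le> 8"
    and gap: "gapped D E (pair_sums R)" and E: "4 * D + 6 \<le> E"
begin


lemma s2_pair_sum_cut:
  assumes "S \<subseteq> R \<times> R" "T \<subseteq> R \<times> R"
    and "\<And>a b. (a, b) \<in> S \<Longrightarrow> a + b \<le> u" "\<And>a b. (a, b) \<in> T \<Longrightarrow> u + 6 < a + b"
  shows "s2 (pair_sum (S \<union> T)) = s2 (pair_sum S) + s2 (pair_sum T)"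
  using assms(3,4) by (intro s2_pair_sum_Un [OF fin card8 assms(1,2)]) fastforce

text \<open>The terms of the square of a binomial sit near \<open>2 * x\<close>,
  \<open>x + y\<close> and \<open>2 * y\<close>, too far apart to interact.\<close>

lemma two_blocks:
  assumes R: "R = A \<union> B" "A \<inter> B = {}"
    and A: "\<And>a. a \<in> A \<Longrightarrow> x \<le> a \<and> a \<le> x + D" and B: "\<And>b. b \<in> B \<Longrightarrow> y \<le> b \<and> b \<le> y + D"
    and sep: "x + E < y"
  shows "s2 (set_encode R ^ 2) = s2 (set_encode A ^ 2) + s2 (set_encode A * set_encode B) +
    s2 (set_encode B ^ 2)"
proof -
  have fA: "finite A" and fB: "finite B"
    using fin unfolding R(1) by simp_all
  have "R \<times> R = A \<times> A \<union> ((A \<times> B \<union> B \<times> A) \<union> B \<times> B)"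
    unfolding R(1) by auto
  then have "s2 (pair_sum (R \<times> R)) = s2 (pair_sum (A \<times> A \<union> ((A \<times> B \<union> B \<times> A) \<union> B \<times> B)))"
    by simp
  also have "\<dots> = s2 (pair_sum (A \<times> A)) + s2 (pair_sum ((A \<times> B \<union> B \<times> A) \<union> B \<times> B))"
    by (rule s2_pair_sum_cut [where u = "2 * (x + D)"], (auto simp: R(1))[2])
      (use sep E in \<open>auto dest!: A B\<close>)
  also have "s2 (pair_sum ((A \<times> B \<union> B \<times> A) \<union> B \<times> B)) =
      s2 (pair_sum (A \<times> B \<union> B \<times> A)) + s2 (pair_sum (B \<times> B))"
    by (rule s2_pair_sum_cut [where u = "x + y + 2 * D"], (auto simp: R(1))[2])
      (use sep E in \<open>auto dest!: A B\<close>)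
  finally show ?thesis
    using pair_sum_cross [OF fA fB R(2)] by (simp add: pair_sum_Times power2_eq_square)
qed

text \<open>The order of \<open>x + z\<close> and \<open>y + y\<close> is unknown and their clusters
  may overlap, so both are put into \<open>?M\<close>, which is credited with one digit
  only.\<close>

lemma three_blocks:
  assumes R: "R = A \<union> B \<union> C" "A \<inter> B = {}" "(A \<union> B) \<inter> C = {}" and "B \<noteq> {}"
    and A: "\<And>a. a \<in> A \<Longrightarrow> x \<le> a \<and> a \<le> x + D" and B: "\<And>b. b \<in> B \<Longrightarrow> y \<le> b \<and> b \<le> y + D"
    and C: "\<And>b. b \<in> C \<Longrightarrow> z \<le> b \<and> b \<le> z + D"
    and sep: "x + E < y" "y + E < z"
  shows "s2 (set_encode A ^ 2) + s2 (set_encode A * set_encode B) + 1 +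
    s2 (set_encode B * set_encode C) + s2 (set_encode C ^ 2) \<le> s2 (set_encode R ^ 2)"
proof -
  have f: "finite A" "finite B" "finite C"
    using fin unfolding R(1) by simp_all
  let ?M = "A \<times> C \<union> C \<times> A \<union> B \<times> B" and ?AB = "A \<times> B \<union> B \<times> A" and ?BC = "B \<times> C \<union> C \<times> B"
  have "R \<times> R = A \<times> A \<union> (?AB \<union> (?M \<union> (?BC \<union> C \<times> C)))"
    unfolding R(1) by auto
  then have "s2 (pair_sum (R \<times> R)) = s2 (pair_sum (A \<times> A \<union> (?AB \<union> (?M \<union> (?BC \<union> C \<times> C)))))"
    by simp
  also have "\<dots> = s2 (pair_sum (A \<times> A)) + s2 (pair_sum (?AB \<union> (?M \<union> (?BC \<union> C \<times> C))))"
    by (rule s2_pair_sum_cut [where u = "2 * (x + D)"], (auto simp: R(1))[2])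
      (use sep E in \<open>auto dest!: A B C\<close>)
  also have "s2 (pair_sum (?AB \<union> (?M \<union> (?BC \<union> C \<times> C)))) =
      s2 (pair_sum ?AB) + s2 (pair_sum (?M \<union> (?BC \<union> C \<times> C)))"
    by (rule s2_pair_sum_cut [where u = "x + y + 2 * D"], (auto simp: R(1))[2])
      (use sep E in \<open>auto dest!: A B C\<close>)
  also have "s2 (pair_sum (?M \<union> (?BC \<union> C \<times> C))) = s2 (pair_sum ?M) + s2 (pair_sum (?BC \<union> C \<times> C))"
    by (rule s2_pair_sum_cut [where u = "max (x + z) (y + y) + 2 * D"], (auto simp: R(1))[2])
      (use sep E in \<open>auto dest!: A B C\<close>)
  also have "s2 (pair_sum (?BC \<union> C \<times> C)) = s2 (pair_sum ?BC) + s2 (pair_sum (C \<times> C))"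
    by (rule s2_pair_sum_cut [where u = "y + z + 2 * D"], (auto simp: R(1))[2])
      (use sep E in \<open>auto dest!: A B C\<close>)
  finally have "s2 (pair_sum (R \<times> R)) = s2 (pair_sum (A \<times> A)) + (s2 (pair_sum ?AB) +
      (s2 (pair_sum ?M) + (s2 (pair_sum ?BC) + s2 (pair_sum (C \<times> C)))))" .
  moreover obtain b where "b \<in> B"
    using \<open>B \<noteq> {}\<close> by blast
  then have "1 \<le> s2 (pair_sum ?M)"
    using f by (intro s2_pos pair_sum_pos [where t = "(b, b)"]) auto
  moreover have "B \<inter> C = {}"
    using R(3) by blast
  ultimately show ?thesis
    using pair_sum_cross [of A B] pair_sum_cross [of B C] f R(2)
    by (simp add: pair_sum_Times power2_eq_square)
qed

text \<open>All products except the two outermost kinds at either end are gathered in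
  \<open>?M\<close>; it contains the separated sums \<open>y + y\<close>, \<open>y + z\<close>,
  \<open>z + z\<close>, whence the \<open>3\<close>.\<close>

lemma four_blocks:
  assumes R: "R = A \<union> B \<union> (C \<union> H)" "A \<inter> B = {}" "C \<inter> H = {}" "(A \<union> B) \<inter> (C \<union> H) = {}"
    and mem: "y \<in> B" "z \<in> C"
    and A: "\<And>a. a \<in> A \<Longrightarrow> x \<le> a \<and> a \<le> x + D" and B: "\<And>b. b \<in> B \<Longrightarrow> y \<le> b \<and> b \<le> y + D"
    and C: "\<And>b. b \<in> C \<Longrightarrow> z \<le> b \<and> b \<le> z + D" and H: "\<And>b. b \<in> H \<Longrightarrow> w \<le> b \<and> b \<le> w + D"
    and sep: "x + E < y" "y + E < z" "z + E < w"
  shows "s2 (set_encode A ^ 2) + s2 (set_encode A * set_encode B) + 3 +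
    s2 (set_encode C * set_encode H) + s2 (set_encode H ^ 2) \<le> s2 (set_encode R ^ 2)"
proof -
  have f: "finite A" "finite B" "finite C" "finite H"
    using fin unfolding R(1) by simp_all
  let ?AB = "A \<times> B \<union> B \<times> A" and ?CH = "C \<times> H \<union> H \<times> C"
  let ?M = "A \<times> (C \<union> H) \<union> (C \<union> H) \<times> A \<union> B \<times> (B \<union> C \<union> H) \<union> (C \<union> H) \<times> B \<union> C \<times> C"
  have "R \<times> R = A \<times> A \<union> (?AB \<union> (?M \<union> (?CH \<union> H \<times> H)))"
    unfolding R(1) by auto
  then have "s2 (pair_sum (R \<times> R)) = s2 (pair_sum (A \<times> A \<union> (?AB \<union> (?M \<union> (?CH \<union> H \<times> H)))))"
    by simp
  also have "\<dots> = s2 (pair_sum (A \<times> A)) + s2 (pair_sum (?AB \<union> (?M \<union> (?CH \<union> H \<times> H))))"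
    by (rule s2_pair_sum_cut [where u = "2 * (x + D)"], (auto simp: R(1))[2])
      (use sep E in \<open>auto dest!: A B C H\<close>)
  also have "s2 (pair_sum (?AB \<union> (?M \<union> (?CH \<union> H \<times> H)))) =
      s2 (pair_sum ?AB) + s2 (pair_sum (?M \<union> (?CH \<union> H \<times> H)))"
    by (rule s2_pair_sum_cut [where u = "x + y + 2 * D"], (auto simp: R(1))[2])
      (use sep E in \<open>auto dest!: A B C H\<close>)
  also have "s2 (pair_sum (?M \<union> (?CH \<union> H \<times> H))) = s2 (pair_sum ?M) + s2 (pair_sum (?CH \<union> H \<times> H))"
    by (rule s2_pair_sum_cut [where u = "max (y + w) (z + z) + 2 * D"], (auto simp: R(1))[2])
      (use sep E in \<open>auto dest!: A B C H\<close>)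
  also have "s2 (pair_sum (?CH \<union> H \<times> H)) = s2 (pair_sum ?CH) + s2 (pair_sum (H \<times> H))"
    by (rule s2_pair_sum_cut [where u = "z + w + 2 * D"], (auto simp: R(1))[2])
      (use sep E in \<open>auto dest!: A B C H\<close>)
  finally have "s2 (pair_sum (R \<times> R)) = s2 (pair_sum (A \<times> A)) + (s2 (pair_sum ?AB) +
      (s2 (pair_sum ?M) + (s2 (pair_sum ?CH) + s2 (pair_sum (H \<times> H)))))" .
  moreover have "card {y + y, y + z, z + z} \<le> s2 (pair_sum ?M)"
  proof (rule card_le_s2_pair_sum [OF fin card8 gap])
    show "?M \<subseteq> R \<times> R"
      unfolding R(1) by auto
    have "(y, y) \<in> ?M" "(y, z) \<in> ?M" "(z, z) \<in> ?M"
      using mem by auto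
    then show "{y + y, y + z, z + z} \<subseteq> (\<lambda>(a, b). a + b) ` ?M"
      by (intro insert_subsetI empty_subsetI) (rule rev_image_eqI, assumption, simp)+
  qed (use sep E in auto)
  moreover have "card {y + y, y + z, z + z} = 3"
    using sep by simp
  ultimately show ?thesis
    using pair_sum_cross [of A B] pair_sum_cross [of C H] f R(2,3)
    by (simp add: pair_sum_Times power2_eq_square)
qed

text \<open>Neighbours in the chain \<open>?Q\<close> differ by a difference of consecutive
  \<open>x0, ..., x4\<close>, hence by more than \<open>E\<close>.\<close>

lemma five_blocks:
  assumes mem: "x0 \<in> R" "x1 \<in> R" "x2 \<in> R" "x3 \<in> R" "x4 \<in> R"
    and sep: "x0 + E < x1" "x1 + E < x2" "x2 + E < x3" "x3 + E < x4"
  shows "9 \<le> s2 (set_encode R ^ 2)"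
proof -
  let ?Q = "{x0 + x0, x0 + x1, x1 + x1, x1 + x2, x2 + x2, x2 + x3, x3 + x3, x3 + x4, x4 + x4}"
  have "card ?Q \<le> s2 (pair_sum (R \<times> R))"
  proof (rule card_le_s2_pair_sum [OF fin card8 gap])
    show "?Q \<subseteq> (\<lambda>(a, b). a + b) ` (R \<times> R)"
      using mem by (intro insert_subsetI empty_subsetI pair_sumsI)
  qed (use sep E in auto)
  moreover have "card ?Q = 9"
    using sep by simp
  ultimately show ?thesis
    by (simp add: pair_sum_Times power2_eq_square)
qed

end

subsection \<open>Squares with few digits\<close>

lemma odd_part:
  assumes "0 < (n::nat)"
  obtains j m where "n = 2 ^ j * m" "odd m"
  using multiplicity_decompose' [of n 2] assms by (metis nat_dvd_1_iff_1 neq0_conv numeral_eq_one_iff semiring_norm(85))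

lemma odd_s2_eq_2:
  assumes "odd n" "s2 n = 2"
  obtains d where "1 \<le> d" "n = 2 ^ d + 1"
proof -
  obtain v where v: "n = Suc (2 * v)"
    using \<open>odd n\<close> by (auto elim: oddE)
  with assms obtain j where "v = 2 ^ j"
    using s2_double_Suc [of v] s2_eq_1_iff [of v] by auto
  with v show ?thesis
    by (intro that [of "Suc j"]) auto
qed

lemma odd_s2_eq_3:
  assumes "odd n" "s2 n = 3"
  obtains b d where "1 \<le> b" "1 \<le> d" "n = 2 ^ b * (2 ^ d + 1) + 1"
proof -
  obtain v where v: "n = Suc (2 * v)"
    using \<open>odd n\<close> by (auto elim: oddE)
  then have "s2 v = 2"
    using assms s2_double_Suc [of v] by simp
  then have "0 < v"
    by (cases "v = 0") auto
  then obtain j w where w: "v = 2 ^ j * w" "odd w"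
    by (rule odd_part)
  then obtain d where "1 \<le> d" "w = 2 ^ d + 1"
    using odd_s2_eq_2 [of w] \<open>s2 v = 2\<close> s2_power_mult by auto
  with v w show ?thesis
    by (intro that [of "Suc j" d]) auto
qed

lemma odd_square:
  assumes "odd (n::nat)"
  obtains u where "n = 2 * u + 1" "n\<^sup>2 = 4 * (u * (u + 1)) + 1"
  using assms by (auto elim!: oddE simp: power2_eq_square algebra_simps)

text \<open>The consecutive numbers \<open>u\<close> and \<open>u + 1\<close> both divide a power of
  two, which leaves only \<open>u = 1\<close>.\<close>

lemma odd_s2_square_eq_2:
  assumes "odd n" "s2 (n\<^sup>2) = 2"
  shows "n = 3"
proof -
  obtain u where u: "n = 2 * u + 1" "n\<^sup>2 = 4 * (u * (u + 1)) + 1"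
    using odd_square [OF assms(1)] .
  obtain d where "n\<^sup>2 = 2 ^ d + 1"
    using odd_s2_eq_2 [of "n\<^sup>2"] assms by auto
  then have "u * (u + 1) dvd 2 ^ d"
    using u(2) by (metis add_right_cancel dvd_triv_right)
  then obtain i j where "u = 2 ^ i" "u + 1 = 2 ^ j"
    using divides_primepow_nat [OF two_is_prime_nat] by (meson dvd_mult_left dvd_mult_right)
  then have "u = 1"
    by (cases i; cases j) (simp_all, presburger)
  then show ?thesis
    using u by simp
qed

lemma square_bracket_unique:
  fixes p q :: nat
  assumes "p\<^sup>2 \<le> N" "N < (p + 1)\<^sup>2" "q\<^sup>2 \<le> N" "N < (q + 1)\<^sup>2"
  shows "p = q"
proof -
  have "p\<^sup>2 < (q + 1)\<^sup>2" "q\<^sup>2 < (p + 1)\<^sup>2"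
    using assms by linarith+
  then have "p < q + 1" "q < p + 1"
    using power_less_imp_less_base by blast+
  then show ?thesis by simp
qed

text \<open>Such a \<open>p\<close> consists of leading binary digits of \<open>\<surd>2\<close>, and the sixth digit \<open>1\<close>
  occurs among the first fourteen.\<close>

lemma few_digits_sqrt_2_prefix:
  assumes "p\<^sup>2 < 2 ^ f" "2 ^ f < (p + 1)\<^sup>2" "s2 p \<le> 5"
  shows "(p, f) \<in> {(1, 1), (2, 3), (5, 5), (11, 7), (22, 9), (45, 11), (90, 13), (181, 15), (362, 17),
    (724, 19), (1448, 21), (2896, 23), (5792, 25)}"
proof -
  \<comment> \<open>For even \<open>f\<close> a square would lie strictly between two consecutive
    squares.\<close>
  have "odd f"
  proof
    assume "even f"
    then obtain h where "(2::nat) ^ f = (2 ^ h)\<^sup>2"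
      by (metis evenE mult.commute power_mult)
    then have "p < 2 ^ h" "(2::nat) ^ h < p + 1"
      using assms power_less_imp_less_base by (metis zero_le)+
    then show False by simp
  qed
  then obtain h where f: "f = 2 * h + 1"
    by (auto elim: oddE)
  have "h < 13"
  proof (rule ccontr)
    assume "\<not> h < 13"
    \<comment> \<open>Dropping the last \<open>m\<close> digits of \<open>p\<close> leaves the
      integer part of the square root of \<open>2 ^ 27\<close>, which is \<open>11585\<close>, a
      number of fourteen digits with six digits \<open>1\<close>.\<close>
    then have m: "f = 27 + 2 * (h - 13)"
      using f by simp
    define m where "m = h - 13"
    note m = m [folded m_def]
    define q where "q = p div 2 ^ m"
    have "2 ^ m * q \<le> p" "p + 1 \<le> 2 ^ m * (q + 1)"
      unfolding q_def using dividend_less_times_div [of "2 ^ m" p] by (auto simp: mult.commute)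
    then have "(2 ^ m * q)\<^sup>2 \<le> p\<^sup>2" "(p + 1)\<^sup>2 \<le> (2 ^ m * (q + 1))\<^sup>2"
      by (simp_all only: power_mono zero_le)
    moreover have "(2::nat) ^ f = (2 ^ m)\<^sup>2 * 2 ^ 27"
      by (simp only: m power_add power_even_eq mult.commute [of "2 ^ 27"])
    ultimately have "(2 ^ m)\<^sup>2 * q\<^sup>2 < (2 ^ m)\<^sup>2 * 2 ^ 27" "(2 ^ m)\<^sup>2 * 2 ^ 27 < (2 ^ m)\<^sup>2 * (q + 1)\<^sup>2"
      using assms unfolding power_mult_distrib by linarith+
    then have "q\<^sup>2 \<le> 2 ^ 27" "2 ^ 27 < (q + 1)\<^sup>2"
      by simp_all
    then have "q = 11585"
      using square_bracket_unique [of q "2 ^ 27" 11585] by simp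
    moreover have "s2 11585 = 6"
      by (simp add: s2.simps)
    ultimately show False
      using s2_div_power_2_le [of p m] assms(3) by (simp add: q_def)
  qed
  then have h: "h \<in> {0, 1, 2, 3, 4, 5, 6, 7, 8, 9, 10, 11, 12}"
    by (simp, presburger)
  have bracket: "p = q" if "q\<^sup>2 \<le> 2 ^ f" "2 ^ f < (q + 1)\<^sup>2" for q
    using square_bracket_unique [OF _ assms(2) that] assms(1) by simp
  show ?thesis
    using h bracket [of 1] bracket [of 2] bracket [of 5] bracket [of 11] bracket [of 22] bracket [of 45]
      bracket [of 90] bracket [of 181] bracket [of 362] bracket [of 724] bracket [of 1448]
      bracket [of 2896] bracket [of 5792]
    unfolding f by (elim insertE emptyE) (simp_all add: power2_eq_square)
qed

text \<open>The special case of Szalay's theorem on \<open>n\<^sup>2 = 2 ^ a + 2 ^ b + 1\<close> in which \<open>n\<close> has at most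
  six digits \<open>1\<close>. Writing \<open>n = 2 ^ (g + 1) * c \<plusminus> 1\<close>, the number \<open>c\<close> or \<open>c - 1\<close> turns out to be
  the integer part of the square root of a power of two.\<close>

lemma odd_s2_square_eq_3:
  assumes "odd n" "s2 (n\<^sup>2) = 3" "4 \<le> s2 n" "s2 n \<le> 6"
  shows "n = 23"
proof -
  obtain u where u: "n = 2 * u + 1" "n\<^sup>2 = 4 * (u * (u + 1)) + 1"
    using odd_square [OF assms(1)] .
  obtain b d where bd: "1 \<le> b" "1 \<le> d" "n\<^sup>2 = 2 ^ b * (2 ^ d + 1) + 1"
    using odd_s2_eq_3 [of "n\<^sup>2"] assms by auto
  have s2u: "s2 n = Suc (s2 u)"
    using s2_double_Suc [of u] u by simp
  have eq4: "4 * (u * (u + 1)) = 2 ^ b * (2 ^ d + 1)"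
    using u bd by simp
  have oddd: "odd ((2::nat) ^ d + 1)"
    using bd by simp
  \<comment> \<open>One of \<open>u\<close>, \<open>u + 1\<close> is even, so \<open>8\<close>
    divides the left side of \<open>eq4\<close>; the factor \<open>2 ^ d + 1\<close> is odd, so
    \<open>2 ^ b\<close> absorbs it all and \<open>g \<ge> 1\<close>.\<close>
  have "2 ^ 3 dvd (2::nat) ^ b * (2 ^ d + 1)"
  proof -
    have "4 * 2 dvd 4 * (u * (u + 1))"
      by (intro mult_dvd_mono) auto
    then show ?thesis
      unfolding eq4 by simp
  qed
  moreover have "coprime ((2::nat) ^ 3) (2 ^ d + 1)"
    using oddd by (metis coprime_left_2_iff_odd coprime_power_left_iff)
  ultimately have "2 ^ 3 dvd (2::nat) ^ b"
    by (metis coprime_dvd_mult_left_iff)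
  then have "3 \<le> b"
    by (rule power_dvd_imp_le) simp
  then have g: "b = (b - 2) + 2" "1 \<le> b - 2"
    by simp_all
  define g where "g = b - 2"
  note g = g [folded g_def]
  have eq: "u * (u + 1) = 2 ^ g * (2 ^ d + 1)"
    using eq4 unfolding g(1) by (simp add: power_add)
  show ?thesis
  \<comment> \<open>By coprimality \<open>2 ^ g\<close> divides whichever of \<open>u\<close>,
    \<open>u + 1\<close> is even; the cases are \<open>n = 2 ^ (g + 1) * c + 1\<close> and
    \<open>n = 2 ^ (g + 1) * c - 1\<close>.\<close>
  proof (cases "even u")
    case True
    then have "coprime (2 ^ g) (u + 1)"
      by simp
    then have "2 ^ g dvd u"
      using eq by (metis coprime_dvd_mult_left_iff dvd_triv_left)
    then obtain c where c: "u = 2 ^ g * c"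
      by (auto simp: dvd_def)
    have eqc: "c * (2 ^ g * c + 1) = 2 ^ d + 1"
      using eq unfolding c mult.assoc by (subst (asm) mult_left_cancel) simp_all
    have "odd c"
      using oddd eqc by (metis even_mult_iff)
    have s2c: "s2 u = s2 c"
      by (simp add: c s2_power_mult)
    have "1 < c"
    proof (rule ccontr)
      assume "\<not> 1 < c"
      then have "c = 0 \<or> c = 1"
        by auto
      then show False
        using s2c s2u assms(3) by auto
    qed
    have "2 ^ g * c\<^sup>2 + (c - 1) = 2 ^ d"
      using eqc \<open>1 < c\<close> by (simp add: power2_eq_square algebra_simps)
    moreover have "2 ^ g * 1 \<le> 2 ^ g * c\<^sup>2"
      using \<open>1 < c\<close> by (intro mult_le_mono) auto
    ultimately have "(2::nat) ^ g \<le> 2 ^ d"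
      by linarith
    then obtain f where f: "d = g + f"
      using le_Suc_ex power_increasing_iff [of "2::nat" g d] by auto
    have "2 ^ g dvd 2 ^ g * c\<^sup>2 + (c - 1)"
      unfolding \<open>2 ^ g * c\<^sup>2 + (c - 1) = 2 ^ d\<close> f by (simp add: power_add)
    then have "2 ^ g dvd c - 1"
      by (simp add: dvd_add_right_iff)
    then obtain e where e: "c - 1 = 2 ^ g * e"
      by (auto simp: dvd_def)
    have "2 ^ g * (c\<^sup>2 + e) = 2 ^ g * 2 ^ f"
      using \<open>2 ^ g * c\<^sup>2 + (c - 1) = 2 ^ d\<close> unfolding e f by (simp add: power_add algebra_simps)
    then have ce: "c\<^sup>2 + e = 2 ^ f"
      by simp
    have "0 < e"
      using e \<open>1 < c\<close> by (cases "e = 0") auto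
    have "e < c"
    proof -
      have "1 * e \<le> 2 ^ g * e"
        by (intro mult_le_mono) auto
      then show ?thesis
        using e \<open>1 < c\<close> by linarith
    qed
    have lower: "c\<^sup>2 < 2 ^ f"
      using ce \<open>0 < e\<close> by linarith
    have upper: "2 ^ f < (c + 1)\<^sup>2"
      using ce \<open>e < c\<close> by (simp add: power2_eq_square flip: ce)
    have digits: "s2 c \<le> 5"
      using s2c s2u assms by simp
    \<comment> \<open>The odd candidates \<open>c > 1\<close> are \<open>5\<close>,
      \<open>11\<close>, \<open>45\<close>, \<open>181\<close>, and for each the remainder
      \<open>e\<close> fails to divide \<open>c - 1\<close>.\<close>
    note few_digits_sqrt_2_prefix [OF lower upper digits]
    moreover have "e dvd c - 1"
      unfolding e by simp
    moreover have "e = 2 ^ f - c\<^sup>2"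
      using ce by linarith
    ultimately show ?thesis
      using \<open>odd c\<close> \<open>1 < c\<close> by (elim insertE emptyE) (simp_all add: dvd_eq_mod_eq_0)
  next
    case False
    then have "coprime (2 ^ g) u"
      by simp
    then have "2 ^ g dvd u + 1"
      using eq by (metis coprime_dvd_mult_right_iff dvd_triv_left)
    then obtain c where c: "u + 1 = 2 ^ g * c"
      by (auto simp: dvd_def)
    have "u * c = 2 ^ d + 1"
      using eq unfolding c mult.left_commute [of u] by (subst (asm) mult_left_cancel) simp_all
    then have "odd c"
      using oddd by (metis even_mult_iff)
    then have "1 \<le> c"
      by (cases c) auto
    \<comment> \<open>In binary, \<open>2 ^ g * c - 1\<close> is \<open>c - 1\<close> followed by
      \<open>g\<close> digits \<open>1\<close>.\<close>
    have s2c: "s2 u = s2 (c - 1) + g"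
    proof -
      have "s2 (2 ^ g * c - 1) = s2 (c - 1) + g"
      proof (induction g)
        case (Suc g)
        have "1 \<le> 2 ^ g * c" "2 ^ Suc g * c = 2 * (2 ^ g * c)"
          using \<open>1 \<le> c\<close> by simp_all
        then have "2 ^ Suc g * c - 1 = Suc (2 * (2 ^ g * c - 1))"
          by linarith
        then show ?case
          using Suc by (simp only: s2_double_Suc)
      qed simp
      then show ?thesis
        using c by (metis add_diff_cancel_right')
    qed
    have eqc: "2 ^ g * c\<^sup>2 = 2 ^ d + 1 + c"
    proof -
      have "2 ^ g * c\<^sup>2 = (u + 1) * c"
        unfolding c by (simp add: power2_eq_square)
      then show ?thesis
        using \<open>u * c = 2 ^ d + 1\<close> by simp
    qed
    \<comment> \<open>For \<open>c = 1\<close> the digit bound gives \<open>g \<ge> 3\<close>, which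
      rules out \<open>n = 7\<close>; otherwise \<open>2 ^ g = 2 ^ d + 2\<close> fails modulo
      \<open>4\<close>.\<close>
    have "c \<noteq> 1"
    proof
      assume "c = 1"
      then have g3: "3 \<le> g" and pow: "2 ^ g = (2::nat) ^ d + 2"
        using s2c s2u assms(3) eqc by auto
      have "d \<noteq> 1"
        using pow power_increasing [OF g3, of "2::nat"] by auto
      then have "2\<^sup>2 dvd (2::nat) ^ d" "2\<^sup>2 dvd (2::nat) ^ g"
        using bd(2) g3 by (intro le_imp_power_dvd; simp)+
      then have "2\<^sup>2 dvd (2::nat)"
        unfolding pow by (metis dvd_add_right_iff)
      then show False by simp
    qed
    then have "3 \<le> c"
      using \<open>odd c\<close> by (auto elim!: oddE)
    have "2 ^ g \<le> (2::nat) ^ d"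
    proof -
      have "2 * (c\<^sup>2 - 1) \<le> 2 ^ g * (c\<^sup>2 - 1)"
        using g(2) power_increasing [of 1 g "2::nat"] by (intro mult_le_mono1) simp
      moreover have "c + 1 \<le> 2 * (c\<^sup>2 - 1)"
        using mult_le_mono1 [OF \<open>3 \<le> c\<close>, of c] \<open>3 \<le> c\<close> unfolding power2_eq_square by linarith
      moreover have "2 ^ g * (c\<^sup>2 - 1) + 2 ^ g = 2 ^ g * c\<^sup>2"
        using \<open>3 \<le> c\<close> by (simp add: algebra_simps)
      ultimately show ?thesis
        using eqc by linarith
    qed
    then have "g \<le> d"
      by simp
    then obtain f where f: "d = g + f"
      using le_Suc_ex by blast
    have "2 ^ g dvd 2 ^ d + (c + 1)"
      using eqc by (metis add.assoc add.commute dvd_triv_left)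
    then have "2 ^ g dvd c + 1"
      unfolding f power_add by (metis dvd_add_right_iff dvd_triv_left)
    then obtain e where e: "c + 1 = 2 ^ g * e"
      by (auto simp: dvd_def)
    have "2 ^ g * c\<^sup>2 = 2 ^ g * (2 ^ f + e)"
      using eqc e unfolding f power_add distrib_left by simp
    then have ce: "c\<^sup>2 = 2 ^ f + e"
      by simp
    have "0 < e"
      using e by (cases "e = 0") auto
    have "2 * e \<le> c + 1"
      unfolding e using g(2) power_increasing [of 1 g "2::nat"] by (intro mult_le_mono1) simp
    \<comment> \<open>Here \<open>c\<^sup>2\<close> exceeds \<open>2 ^ f\<close> by a small
      \<open>e\<close>, so the integer part of the root is \<open>c - 1\<close>.\<close>
    obtain p where p: "c = Suc p"
      using \<open>3 \<le> c\<close> by (cases c) auto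
    have upper: "2 ^ f < (p + 1)\<^sup>2"
      using ce \<open>0 < e\<close> p by simp
    have "p\<^sup>2 + 2 * p + 1 = 2 ^ f + e"
      using ce unfolding p by (simp add: power2_eq_square)
    then have lower: "p\<^sup>2 < 2 ^ f"
      using \<open>2 * e \<le> c + 1\<close> \<open>3 \<le> c\<close> unfolding p by simp
    have digits: "s2 p \<le> 5"
      using s2c s2u p assms by simp
    note few_digits_sqrt_2_prefix [OF lower upper digits]
    moreover have "e dvd Suc (Suc p)"
      using dvd_triv_right [of e "2 ^ g"] unfolding e [symmetric] p by simp
    moreover have "e = (Suc p)\<^sup>2 - 2 ^ f"
      using ce p by simp
    moreover have "even p"
      using \<open>odd c\<close> p by simp
    \<comment> \<open>Among the even candidates only \<open>2\<close> passes the divisibility test;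
      then \<open>c = 3\<close> and \<open>2 ^ g = 4\<close>.\<close>
    ultimately have "p = 2 \<and> e = 1"
      by (elim insertE emptyE) (simp_all add: dvd_eq_mod_eq_0)
    then have "u = 11"
      using c e p by simp
    then show ?thesis
      by (simp add: u)
  qed
qed

section \<open>Lower bounds for digit sums of squares\<close>

lemma s2_square_power_mult: "s2 ((2 ^ j * m)\<^sup>2) = s2 (m\<^sup>2)"
  by (simp only: power_mult_distrib power_even_eq [symmetric] s2_power_mult)

lemma s2_square_ge_2: "2 \<le> s2 x \<Longrightarrow> 2 \<le> s2 (x\<^sup>2)"
  unfolding power2_eq_square by (rule s2_mult_ge_2) (auto intro: gr0I)

lemma s2_square_ge_3:
  assumes "2 \<le> s2 x"
  shows "3 \<le> s2 (x\<^sup>2) \<or> (\<exists>j. x = 2 ^ j * 3)"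
proof -
  have "0 < x"
    using assms by (cases x) auto
  then obtain j m where "x = 2 ^ j * m" "odd m"
    by (rule odd_part)
  then show ?thesis
    using odd_s2_square_eq_2 [of m] s2_square_ge_2 [OF assms] s2_square_power_mult [of j m]
    by fastforce
qed

text \<open>The numbers \<open>3\<close> and \<open>23\<close> are the exceptional odd parts;
  \<open>683\<close> is \<open>(2 ^ 11 + 1) div 3\<close>, met in
  \<open>s2_triple_square\<close>.\<close>

lemma s2_3_23: "s2 3 = 2" "s2 23 = 4" "s2 (23\<^sup>2) = 3" "s2 683 = 6" "s2 (683\<^sup>2) = 11"
  by (simp_all add: s2.simps)

lemma s2_square_ge_4:
  assumes "4 \<le> s2 x" "s2 x \<le> 6"
  shows "4 \<le> s2 (x\<^sup>2) \<or> s2 (x\<^sup>2) = 3 \<and> (\<exists>j. x = 2 ^ j * 23)"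
proof -
  have "0 < x"
    using assms by (cases x) auto
  then obtain j m where x: "x = 2 ^ j * m" "odd m"
    by (rule odd_part)
  have "3 \<le> s2 (x\<^sup>2)"
    using s2_square_ge_3 [of x] assms s2_3_23(1) s2_power_mult by fastforce
  then show ?thesis
    using odd_s2_square_eq_3 [of m] x assms s2_square_power_mult [of j m] s2_power_mult [of j m]
    by fastforce
qed

text \<open>For \<open>t > 0\<close> the quotient reads \<open>10...1011\<close> in binary,
  \<open>t - 1\<close> pairs \<open>10\<close> followed by \<open>11\<close>; in the induction step
  \<open>m = 4 * v + 3\<close> with \<open>v\<close> even, and \<open>v + 1\<close> is the quotient
  for \<open>t\<close>.\<close>

lemma s2_third_of_power_2_Suc: "3 * m = 2 ^ (2 * t + 1) + 1 \<Longrightarrow> s2 m = t + 1"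
proof (induction t arbitrary: m)
  case (Suc t)
  have "m mod 4 = 3"
  proof -
    have "(3 * m) mod 4 = (4 * 2 ^ (2 * t + 1) + 1) mod 4"
      using Suc.prems by simp
    then show ?thesis
      by presburger
  qed
  then obtain v where v: "m = Suc (2 * Suc (2 * v))"
    by (intro that [of "m div 4"]) presburger
  have "3 * Suc v = 2 ^ (2 * t + 1) + 1"
    using Suc.prems v by simp
  then have "Suc (Suc (3 * v)) = 2 * 2 ^ (2 * t)"
    by simp
  then have "even v"
    by presburger
  then obtain w where "v = 2 * w"
    by (rule evenE)
  then have "s2 (Suc v) = Suc (s2 v)"
    by (simp add: s2_double s2_double_Suc)
  then show ?case
    unfolding v s2_double_Suc using Suc.IH [OF \<open>3 * Suc v = _\<close>] by simp
qed simp

text \<open>With six digits the exception \<open>23\<close> is excluded, so the square has at least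
  \<open>4\<close>. Only \<open>s2 (3 * m) = 2\<close> could spoil the bound; then
  \<open>3 * m\<close> is \<open>2 ^ d + 1\<close>, forcing \<open>m = 683\<close>, whose square has
  \<open>11\<close> digits \<open>1\<close>.\<close>

lemma s2_triple_square:
  assumes "s2 y = 6"
  shows "7 \<le> s2 (3 * y) + s2 (y\<^sup>2)"
proof -
  have "0 < y"
    using assms by (cases y) auto
  then obtain j m where y: "y = 2 ^ j * m" "odd m"
    by (rule odd_part)
  have red: "s2 (3 * y) = s2 (3 * m)" "s2 (y\<^sup>2) = s2 (m\<^sup>2)" "s2 m = 6"
    using assms s2_power_mult [of j m] s2_power_mult [of j "3 * m"] s2_square_power_mult
    by (simp_all add: y mult.left_commute)
  have "4 \<le> s2 (m\<^sup>2)"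
    using s2_square_ge_4 [of m] red(3) s2_power_mult [of _ 23] s2_3_23 by auto
  moreover have "11 \<le> s2 (m\<^sup>2)" if "s2 (3 * m) = 2"
  proof -
    obtain d where d: "3 * m = 2 ^ d + 1"
      using odd_s2_eq_2 [of "3 * m"] \<open>odd m\<close> \<open>s2 (3 * m) = 2\<close> by auto
    have "odd d"
    proof
      assume "even d"
      then obtain t where "d = 2 * t"
        by (auto elim: evenE)
      moreover have "(2::nat) ^ (2 * t) mod 3 = 1"
        by (induction t) (simp, simp, presburger)
      moreover have "(2 ^ d + 1) mod 3 = (0::nat)"
        unfolding d [symmetric] by simp
      ultimately show False
        by presburger
    qed
    then obtain t where t: "d = 2 * t + 1"
      by (auto elim: oddE)
    then have "t = 5"
      using s2_third_of_power_2_Suc [of m t] d red(3) by simp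
    then have "m = 683"
      using d t by simp
    then show ?thesis
      using s2_3_23(5) by simp
  qed
  moreover have "2 \<le> s2 (3 * m)"
    using s2_3_23(1) \<open>odd m\<close> by (intro s2_mult_ge_2) (auto intro: gr0I)
  ultimately show ?thesis
    unfolding red by linarith
qed

subsection \<open>The digit count of separated blocks\<close>

text \<open>With \<open>s2 x \<le> s2 y\<close> and \<open>s2 x \<ge> 2\<close>, the general bounds
  fall short only for digit sums \<open>(2, 6)\<close> and \<open>(4, 4)\<close>, where they give
  just \<open>8\<close>. Equality would need \<open>x = 2 ^ j * 3\<close> in the first case, and odd
  part \<open>23\<close> for both numbers in the second.\<close>

lemma two_block_inequality:
  assumes "1 \<le> s2 x" "1 \<le> s2 y" "s2 x + s2 y \<le> 8"
  shows "s2 x + s2 y < s2 (x\<^sup>2) + s2 (x * y) + s2 (y\<^sup>2)"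
proof -
  have *: "s2 x + s2 y < s2 (x\<^sup>2) + s2 (x * y) + s2 (y\<^sup>2)"
    if le: "s2 x \<le> s2 y" and pos: "1 \<le> s2 x" and bound: "s2 x + s2 y \<le> 8" for x y
  proof -
    have xy: "0 < x" "0 < y"
      using le pos by (auto intro: gr0I)
    then have sq_pos: "1 \<le> s2 (x\<^sup>2)" "1 \<le> s2 (y\<^sup>2)"
      using s2_pos [of "x\<^sup>2"] s2_pos [of "y\<^sup>2"] by simp_all
    show ?thesis
    proof (cases "s2 x = 1")
      case True
      then show ?thesis
        using True s2_eq_1_mult [OF True, of y] sq_pos by linarith
    next
      case False
      then have ge2: "2 \<le> s2 x" "2 \<le> s2 y"
        using le pos by simp_all
      have xy2: "2 \<le> s2 (x * y)"
        using s2_mult_ge_2 [OF ge2(1) xy(2)] .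
      have three: "3 \<le> s2 (z\<^sup>2)" if "3 \<le> s2 z" for z
        using s2_square_ge_3 [of z] that s2_power_mult [of _ 3] s2_3_23(1) by fastforce
      have four: "4 \<le> s2 (z\<^sup>2) \<or> s2 z = 4" if "4 \<le> s2 z" "s2 z \<le> 6" for z
        using s2_square_ge_4 [OF that] s2_power_mult [of _ 23] s2_3_23(2) by fastforce
      have x2: "2 \<le> s2 (x\<^sup>2)" and y2: "2 \<le> s2 (y\<^sup>2)"
        using s2_square_ge_2 ge2 by auto
      consider "s2 x = 2" "s2 y \<le> 5" | "s2 x = 2" "s2 y = 6" | "s2 x = 3" | "s2 x = 4" "s2 y = 4"
        using le ge2 bound by linarith
      then show ?thesis
      proof cases
        case 1
        then show ?thesis
          using three [of y] four [of y] x2 xy2 y2 by linarith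
      next
        case 2
        show ?thesis
        proof (cases "3 \<le> s2 (x\<^sup>2)")
          case True
          then show ?thesis
            using 2 four [of y] xy2 by linarith
        next
          case False
          then obtain j where "x = 2 ^ j * 3"
            using s2_square_ge_3 [OF ge2(1)] by blast
          then have "s2 (x * y) = s2 (3 * y)"
            using s2_power_mult [of j "3 * y"] by (simp add: mult.assoc)
          then show ?thesis
            using 2 s2_triple_square [of y] x2 by linarith
        qed
      next
        case 3
        then show ?thesis
          using three [of x] three [of y] four [of y] xy2 y2 le bound by linarith
      next
        case 4
        show ?thesis
        proof (cases "4 \<le> s2 (x\<^sup>2) \<or> 4 \<le> s2 (y\<^sup>2)")
          case True
          then show ?thesis
            using 4 three [of x] three [of y] xy2 by linarith
        next
          case False
          then obtain i j where "x = 2 ^ i * 23" "y = 2 ^ j * 23"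
            using 4 s2_square_ge_4 [of x] s2_square_ge_4 [of y] by auto
          then have "x * y = 2 ^ (i + j) * 23\<^sup>2"
            by (simp add: power_add power2_eq_square)
          then have "s2 (x * y) = 3"
            by (simp only: s2_power_mult s2_3_23(3))
          then show ?thesis
            using 4 three [of x] three [of y] by linarith
        qed
      qed
    qed
  qed
  show ?thesis
  proof (cases "s2 x \<le> s2 y")
    case True
    then show ?thesis
      using * assms by blast
  next
    case False
    then show ?thesis
      using * [of y x] assms by (simp add: mult.commute add.commute)
  qed
qed

text \<open>Case rule for an outermost block \<open>x\<close> and its neighbour \<open>y\<close>: a
  power of two preserves the digits of \<open>y\<close>, anything else yields two digits in both
  products.\<close>

lemma end_blocks:
  assumes "1 \<le> s2 x" "1 \<le> s2 y"
  obtains "s2 x = 1" "s2 (x * y) = s2 y" "1 \<le> s2 (x\<^sup>2)" | "2 \<le> s2 x" "2 \<le> s2 (x * y)" "2 \<le> s2 (x\<^sup>2)"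
proof -
  have xy: "0 < x" "0 < y"
    using assms by (auto intro: gr0I)
  show ?thesis
  proof (cases "s2 x = 1")
    case True
    then show ?thesis
      using that(1) s2_eq_1_mult s2_pos [of "x\<^sup>2"] xy by simp
  next
    case False
    then have "2 \<le> s2 x"
      using assms by simp
    then show ?thesis
      using that(2) s2_mult_ge_2 s2_square_ge_2 xy by blast
  qed
qed

text \<open>If neither end is a power of two, the bounds sum to \<open>9\<close>. If one is, its
  product keeps all digits of \<open>y\<close>; the extreme case of digit sums
  \<open>6, 1, 1\<close> needs that \<open>y\<close> is a power of two as well.\<close>

lemma three_block_inequality:
  assumes "1 \<le> s2 x" "1 \<le> s2 y" "1 \<le> s2 z" "s2 x + s2 y + s2 z \<le> 8"
  shows "s2 x + s2 y + s2 z < s2 (x\<^sup>2) + s2 (x * y) + 1 + s2 (y * z) + s2 (z\<^sup>2)"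
proof -
  have three: "3 \<le> s2 (w\<^sup>2)" if "3 \<le> s2 w" for w
    using s2_square_ge_3 [of w] that s2_power_mult [of _ 3] s2_3_23(1) by fastforce
  have y1: "s2 (x * y) = s2 x \<and> s2 (y * z) = s2 z" if "s2 y = 1"
    using s2_eq_1_mult [OF that, of x] s2_eq_1_mult [OF that, of z] by (simp add: mult.commute)
  have zy: "s2 (z * y) = s2 (y * z)"
    by (simp add: mult.commute)
  show ?thesis
    by (rule end_blocks [OF assms(1,2)]; rule end_blocks [OF assms(3,2)])
      (use assms three [of x] three [of z] y1 zy in linarith)+
qed

lemma four_block_inequality:
  assumes "1 \<le> s2 x" "1 \<le> s2 y" "1 \<le> s2 z" "1 \<le> s2 w" "s2 x + s2 y + s2 z + s2 w \<le> 8"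
  shows "s2 x + s2 y + s2 z + s2 w < s2 (x\<^sup>2) + s2 (x * y) + 3 + s2 (z * w) + s2 (w\<^sup>2)"
proof -
  have wz: "s2 (w * z) = s2 (z * w)"
    by (simp add: mult.commute)
  show ?thesis
    by (rule end_blocks [OF assms(1,2)]; rule end_blocks [OF assms(4,3)])
      (use assms wz in linarith)+
qed

context gapped_exponents
begin

text \<open>Blocks are peeled off from below; two, three or four blocks contradict the inequalities
  above, and more give at least \<open>9\<close> digits.\<close>

lemma single_block:
  assumes "s2 (set_encode R ^ 2) = card R" "0 \<in> R"
  shows "R \<subseteq> {0..D}"
proof (rule ccontr)
  assume wide: "\<not> ?thesis"
  have gapR: "gapped D E R" "2 * D \<le> E"
    using gapped_summand [OF gap] E by simp_all
  have pos: "1 \<le> card X" if "x \<in> X" "finite X" for x and X :: "nat set"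
    using that by (auto simp: Suc_le_eq card_gt_0_iff)
  obtain x0 A R1 where 0: "R = A \<union> R1" "A \<inter> R1 = {}" "x0 \<in> A"
      "\<And>a. a \<in> A \<Longrightarrow> x0 \<le> a \<and> a \<le> x0 + D" "\<And>a b. a \<in> A \<Longrightarrow> b \<in> R1 \<Longrightarrow> a + E < b"
    using gapped_lowest_block [OF gapR] assms(2) by (metis empty_iff)
  have "x0 = 0"
    using 0 assms(2) by fastforce
  then have "R1 \<noteq> {}"
    using 0(1,4) wide by force
  then obtain x1 B R2 where 1: "R1 = B \<union> R2" "B \<inter> R2 = {}" "x1 \<in> B"
      "\<And>a. a \<in> B \<Longrightarrow> x1 \<le> a \<and> a \<le> x1 + D" "\<And>a b. a \<in> B \<Longrightarrow> b \<in> R2 \<Longrightarrow> a + E < b"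
    using gapped_lowest_block [OF gapped_mono [OF gapR(1), of R1] gapR(2)] 0(1) by (metis Un_upper2)
  have fin01: "finite A" "finite B" "finite R2"
    using fin 0(1) 1(1) by auto
  have sep01: "x0 + E < x1"
    using 0(5) [of x0 x1] 0(3) 1(1,3) by simp
  show False
  proof (cases "R2 = {}")
    case True
    then have "R = A \<union> B" "A \<inter> B = {}"
      using 0 1 by auto
    then show False
      using two_blocks [OF _ _ 0(4) 1(4) sep01] assms(1) card8 fin01 pos [OF 0(3)] pos [OF 1(3)]
        two_block_inequality [of "set_encode A" "set_encode B"]
      by (simp add: s2_set_encode card_Un_disjoint)
  next
    case False
    then obtain x2 C R3 where 2: "R2 = C \<union> R3" "C \<inter> R3 = {}" "x2 \<in> C"
        "\<And>a. a \<in> C \<Longrightarrow> x2 \<le> a \<and> a \<le> x2 + D" "\<And>a b. a \<in> C \<Longrightarrow> b \<in> R3 \<Longrightarrow> a + E < b"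
      using gapped_lowest_block [OF gapped_mono [OF gapR(1), of R2] gapR(2)] 0(1) 1(1)
      by (metis Un_upper2 le_supI2)
    have fin23: "finite C" "finite R3"
      using fin01 2(1) by auto
    have sep12: "x1 + E < x2"
      using 1(5) [of x1 x2] 1(3) 2(1,3) by simp
    show False
    proof (cases "R3 = {}")
      case True
      then have R: "R = A \<union> B \<union> C" "A \<inter> B = {}" "(A \<union> B) \<inter> C = {}"
        using 0(1,2) 1(1,2) 2(1) by auto
      then have "card R = card A + card B + card C"
        using fin01 fin23 by (simp add: card_Un_disjoint)
      moreover have "B \<noteq> {}"
        using 1(3) by blast
      ultimately show False
        using three_blocks [OF R _ 0(4) 1(4) 2(4) sep01 sep12] assms(1) card8 fin01 fin23
          pos [OF 0(3)] pos [OF 1(3)] pos [OF 2(3)]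
          three_block_inequality [of "set_encode A" "set_encode B" "set_encode C"]
        by (simp add: s2_set_encode)
    next
      case False
      then obtain x3 H R4 where 3: "R3 = H \<union> R4" "H \<inter> R4 = {}" "x3 \<in> H"
          "\<And>a. a \<in> H \<Longrightarrow> x3 \<le> a \<and> a \<le> x3 + D" "\<And>a b. a \<in> H \<Longrightarrow> b \<in> R4 \<Longrightarrow> a + E < b"
        using gapped_lowest_block [OF gapped_mono [OF gapR(1), of R3] gapR(2)] 0(1) 1(1) 2(1)
        by (metis Un_upper2 le_supI2)
      have fin4: "finite H"
        using fin23 3(1) by auto
      have sep23: "x2 + E < x3"
        using 2(5) [of x2 x3] 2(3) 3(1,3) by simp
      show False
      proof (cases "R4 = {}")
        case True
        then have R: "R = A \<union> B \<union> (C \<union> H)" "A \<inter> B = {}" "C \<inter> H = {}" "(A \<union> B) \<inter> (C \<union> H) = {}"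
          using 0(1,2) 1(1,2) 2(1,2) 3(1) by auto
        then have "card R = card A + card B + card C + card H"
          using fin01 fin23 fin4 by (simp add: card_Un_disjoint)
        then show False
          using four_blocks [OF R 1(3) 2(3) 0(4) 1(4) 2(4) 3(4) sep01 sep12 sep23] assms(1) card8
            fin01 fin23 fin4 pos [OF 0(3)] pos [OF 1(3)] pos [OF 2(3)] pos [OF 3(3)]
            four_block_inequality [of "set_encode A" "set_encode B" "set_encode C" "set_encode H"]
          by (simp add: s2_set_encode)
      next
        case False
        \<comment> \<open>One exponent beyond the fourth block is enough; the fifth block itself is
          not delimited.\<close>
        then obtain x4 where "x4 \<in> R4"
          by blast
        then have "9 \<le> s2 (set_encode R ^ 2)"
          using 0(1,3) 1(1,3) 2(1,3) 3(1,3,5)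
          by (intro five_blocks [OF _ _ _ _ _ sep01 sep12 sep23, of x4]) auto
        then show False
          using assms(1) card8 by simp
      qed
    qed
  qed
qed

end

subsection \<open>Choice of the scale\<close>

text \<open>Consecutive scales are a pair \<open>D\<close>, \<open>E\<close> satisfying the locale
  condition with equality.\<close>

primrec scale :: "nat \<Rightarrow> nat" where
  "scale 0 = 0"
| "scale (Suc i) = 4 * scale i + 6"

lemma scale_mono: "i \<le> j \<Longrightarrow> scale i \<le> scale j"
  by (rule lift_Suc_mono_le [of scale]) simp_all

text \<open>Each scale that is not a gap accounts for a difference of two elements of \<open>P\<close>, and different
  scales account for different differences.\<close>

lemma gapped_at_some_scale:
  assumes "finite P" "card P \<le> N"
  shows "\<exists>i \<le> N * N. gapped (scale i) (scale (Suc i)) P"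
proof (rule ccontr)
  assume no: "\<not> ?thesis"
  let ?\<Delta> = "(\<lambda>(x, y). y - x) ` (P \<times> P)"
  have "\<exists>\<delta>\<in>?\<Delta>. scale i < \<delta> \<and> \<delta> \<le> scale (Suc i)" if "i \<le> N * N" for i
  proof -
    have "\<not> gapped (scale i) (scale (Suc i)) P"
      using no that by blast
    then obtain x y where "x \<in> P" "y \<in> P" "x \<le> y" "x + scale i < y" "y \<le> x + scale (Suc i)"
      unfolding gapped_def by (auto simp: not_le not_less)
    then show ?thesis
      by (intro bexI [of _ "y - x"]) (auto intro: rev_image_eqI [of "(x, y)"])
  qed
  then obtain \<delta> where \<delta>: "\<And>i. i \<le> N * N \<Longrightarrow> \<delta> i \<in> ?\<Delta> \<and> scale i < \<delta> i \<and> \<delta> i \<le> scale (Suc i)"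
    by metis
  \<comment> \<open>The chosen differences lie in the disjoint intervals from \<open>scale i\<close>
    (excluded) to \<open>scale (Suc i)\<close>.\<close>
  have less: "\<delta> i < \<delta> j" if "i < j" "j \<le> N * N" for i j
    using \<delta> [of i] \<delta> [of j] scale_mono [of "Suc i" j] that by linarith
  have "inj_on \<delta> {..N * N}"
    by (rule linorder_inj_onI') (use less in \<open>auto simp: less_imp_neq\<close>)
  \<comment> \<open>There are \<open>N * N + 1\<close> indices but at most \<open>N * N\<close>
    differences.\<close>
  then have "card {..N * N} \<le> card ?\<Delta>"
    by (rule card_inj_on_le) (use \<delta> assms(1) in auto)
  also have "\<dots> \<le> card (P \<times> P)"
    by (rule card_image_le) (use assms in auto)
  also have "\<dots> \<le> N * N"
    using assms by (simp add: card_cartesian_product mult_le_mono)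
  finally show False by simp
qed

theorem theorem1p3:
  fixes k :: nat
  assumes "0 < k" and "k \<le> 8"
  shows "finite {n :: nat. odd n \<and> s2 (n ^ 2) = k \<and> s2 n = k}"
proof (rule finite_subset)
  \<comment> \<open>At most \<open>8 * 8 = 64\<close> pair sums occur, so a good scale has index at
    most \<open>64 * 64\<close>; this bounds all exponents independently of
    \<open>n\<close>.\<close>
  show "{n :: nat. odd n \<and> s2 (n ^ 2) = k \<and> s2 n = k} \<subseteq> set_encode ` Pow {0..scale (64 * 64)}"
  proof
    fix n assume n: "n \<in> {n :: nat. odd n \<and> s2 (n ^ 2) = k \<and> s2 n = k}"
    define R where "R = set_decode n"
    have R: "finite R" "card R = k" "0 \<in> R" "set_encode R = n"
      using n by (simp_all add: R_def s2_eq_card)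
    have "card (pair_sums R) \<le> card (R \<times> R)"
      by (rule card_image_le) (simp add: R)
    also have "\<dots> \<le> 8 * 8"
      using mult_le_mono [OF assms(2) assms(2)] R by (simp add: card_cartesian_product)
    finally have "card (pair_sums R) \<le> 64"
      by simp
    then obtain i where i: "i \<le> 64 * 64" "gapped (scale i) (scale (Suc i)) (pair_sums R)"
      using gapped_at_some_scale [of "pair_sums R" 64] R(1) by blast
    interpret gapped_exponents "scale i" "scale (Suc i)" R
      by unfold_locales (use R i assms in auto)
    have "R \<subseteq> {0..scale i}"
      using single_block R n by simp
    also have "\<dots> \<subseteq> {0..scale (64 * 64)}"
      using scale_mono [OF i(1)] by simp
    finally show "n \<in> set_encode ` Pow {0..scale (64 * 64)}"
      using R by blast
  qed
qed simp

end
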